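(* Let $\alpha,\beta>0$ and let $(B^*_t)_{t\ge0}$ be the bipartite multigraph process with parameters $\alpha,\beta$ on finite disjoint parts $\mathcal L,\mathcal R$ with $|\mathcal L|=L_n$, $|\mathcal R|=R_n$. Let $t\ge 0$, $A\subset\mathcal L$, $B\subset\mathcal R$, and let $t_1,y\ge0$ be integers with $t_1+y\le t$. Let $\mathcal B_t(A,B,t_1,y)$ be the set of bipartite multigraphs $M$ on $\mathcal L\cup\mathcal R$ with $t$ edges such that every neighbour in $M$ of a vertex of $A$ lies in $B$, $\sum_{u\in A}d_u(M)=t_1$ and $\sum_{v\in B}d_v(M)=t_1+y$. Then $$\mathbb P\big(B^*_t\in\mathcal B_t(A,B,t_1,y)\big)=\binom{t}{t_1}\binom{t-t_1}{y}\cdot\frac{(|A|\alpha)_{t_1}\,((L_n-|A|)\alpha)_{t-t_1}}{(\alpha L_n)_t}\cdot\frac{(|B|\beta)_{t_1+y}\,((R_n-|B|)\beta)_{t-t_1-y}}{(\beta R_n)_t}.$$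
   Context: Multigraph process: $B^*_0$ is the graph on $V=\mathcal L\cup\mathcal R$ with no edges. Given $B^*_t$, one samples a pair $\{u,v\}$, $u\in\mathcal L$, $v\in\mathcal R$ (repetitions allowed), with probability $$\frac{(d_u(t)+\alpha)(d_v(t)+\beta)}{\sum_{x\in\mathcal L,\,y\in\mathcal R}(d_x(t)+\alpha)(d_y(t)+\beta)},$$ where $d_w(t)$ is the degree of $w$ in $B^*_t$ (with multiplicity), and adds the edge $\{u,v\}$ to obtain $B^*_{t+1}$. $d_w(M)$ is the degree (with multiplicity) of $w$ in the multigraph $M$. $(x)_m:=x(x+1)\cdots(x+m-1)$ is the rising factorial, with $(x)_0=1$; by convention $\binom{t-t_1}{0}=1$. *)

theory Defs
  imports "HOL-Probability.Probability"
begin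

text \<open>A multigraph on a fixed vertex set is the multiset of its edges, an edge being the
  (unordered) set of its end points.\<close>

type_synonym 'v multigraph = "'v set multiset"

definition bipartite_multigraphs :: "'v set \<Rightarrow> 'v set \<Rightarrow> 'v multigraph set" where
  "bipartite_multigraphs L R = {M. \<forall>e\<in>#M. \<exists>u\<in>L. \<exists>v\<in>R. e = {u, v}}"

text \<open>Counted with multiplicity; bipartite multigraphs with disjoint parts have no loops.\<close>

definition vdegree :: "'v multigraph \<Rightarrow> 'v \<Rightarrow> nat" where
  "vdegree M w = size {#e \<in># M. w \<in> e#}"

definition neighbours :: "'v multigraph \<Rightarrow> 'v \<Rightarrow> 'v set" where
  "neighbours M u = {v. {u, v} \<in># M}"

definition edge_prob ::
  "'v set \<Rightarrow> 'v set \<Rightarrow> real \<Rightarrow> real \<Rightarrow> 'v multigraph \<Rightarrow> 'v \<Rightarrow> 'v \<Rightarrow> real" where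
  "edge_prob L R \<alpha> \<beta> M u v =
     ((real (vdegree M u) + \<alpha>) * (real (vdegree M v) + \<beta>)) /
     (\<Sum>x\<in>L. \<Sum>y\<in>R. (real (vdegree M x) + \<alpha>) * (real (vdegree M y) + \<beta>))"

text \<open>The process may live on any probability space. The law of the next edge is prescribed
  conditionally on the whole past \<open>H 0, \<dots>, H t\<close> and depends only on the present state \<open>H t\<close>.
  The assumption \<open>step\<close> forces both parts to be nonempty; otherwise there is no edge to
  sample and the process does not exist.\<close>

locale bipartite_multigraph_process = prob_space \<Omega>
  for \<Omega> :: "'o measure" +
  fixes L R :: "'v set" and \<alpha> \<beta> :: real and X :: "nat \<Rightarrow> 'o \<Rightarrow> 'v multigraph"
  assumes measurable_state:
      "\<And>t. X t \<in> measurable \<Omega> (count_space (bipartite_multigraphs L R))"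
    and init: "AE \<omega> in \<Omega>. X 0 \<omega> = {#}"
    and step: "\<And>t. AE \<omega> in \<Omega>. \<exists>u\<in>L. \<exists>v\<in>R. X (Suc t) \<omega> = add_mset {u, v} (X t \<omega>)"
    and transition: "\<And>t H u v. \<P>(\<omega> in \<Omega>. \<forall>s\<le>t. X s \<omega> = H s) > 0 \<Longrightarrow> u \<in> L \<Longrightarrow> v \<in> R \<Longrightarrow>
      \<P>(\<omega> in \<Omega>. X (Suc t) \<omega> = add_mset {u, v} (H t) \<bar> \<forall>s\<le>t. X s \<omega> = H s)
        = edge_prob L R \<alpha> \<beta> (H t) u v"

definition confined_multigraphs ::
  "'v set \<Rightarrow> 'v set \<Rightarrow> nat \<Rightarrow> 'v set \<Rightarrow> 'v set \<Rightarrow> nat \<Rightarrow> nat \<Rightarrow> 'v multigraph set" where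
  "confined_multigraphs L R t A B t1 y =
     {M \<in> bipartite_multigraphs L R.
        size M = t \<and>
        (\<forall>u\<in>A. neighbours M u \<subseteq> B) \<and>
        (\<Sum>u\<in>A. vdegree M u) = t1 \<and>
        (\<Sum>v\<in>B. vdegree M v) = t1 + y}"

end

theory Submission imports Defs begin

text \<open>
  Under confinement an edge at \<open>A\<close> ends in \<open>B\<close>, so the confined multigraphs are those with
  \<open>i = t1\<close> edges between \<open>A\<close> and \<open>B\<close>, \<open>j = y\<close> edges between \<open>L - A\<close> and \<open>B\<close>,
  \<open>k = t - t1 - y\<close> edges between \<open>L - A\<close> and \<open>R - B\<close>, and no others. The normaliser
  of the edge law factorises as \<open>(t + \<alpha> |L|) (t + \<beta> |R|)\<close>, so the triple \<open>(i, j, k)\<close> evolves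
  as an urn whose weights are exactly the quotients of consecutive rising factorials. The formula
  follows by induction on \<open>t\<close> from the recurrence of the trinomial coefficients.
\<close>

section \<open>Degree sums and confinement in bipartite multigraphs\<close>

lemma vdegree_empty [simp]: "vdegree {#} w = 0"
  by (simp add: vdegree_def)

lemma vdegree_add_mset [simp]:
  "vdegree (add_mset e M) w = vdegree M w + of_bool (w \<in> e)"
  by (simp add: vdegree_def)

lemma bipartite_multigraphs_add_mset:
  "u \<in> L \<Longrightarrow> v \<in> R \<Longrightarrow>
    add_mset {u, v} M \<in> bipartite_multigraphs L R \<longleftrightarrow> M \<in> bipartite_multigraphs L R"
  by (auto simp: bipartite_multigraphs_def)

lemma neighbours_add_mset:
  assumes "u \<in> L" "v \<in> R" "w \<in> L" "L \<inter> R = {}"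
  shows "neighbours (add_mset {u, v} M) w = neighbours M w \<union> (if w = u then {v} else {})"
  using assms by (auto simp: neighbours_def doubleton_eq_iff)

text \<open>Since \<open>C\<close> lies in a single part, an edge has at most one end point in
  \<open>C\<close> and contributes 0 or 1 to the degree sum.\<close>

lemma sum_vdegree_eq:
  assumes "finite C" "M \<in> bipartite_multigraphs L R" "L \<inter> R = {}" "C \<subseteq> L \<or> C \<subseteq> R"
  shows "(\<Sum>w\<in>C. vdegree M w) = size {#e \<in># M. e \<inter> C \<noteq> {}#}"
  using assms(2)
proof (induction M)
  case (add e M)
  then obtain u v where uv: "e = {u, v}" "u \<in> L" "v \<in> R"
    by (auto simp: bipartite_multigraphs_def)
  have "(\<Sum>w\<in>C. of_bool (w \<in> e) :: nat) = card (C \<inter> e)"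
    using assms(1) by (simp add: of_bool_def sum.If_cases Int_def)
  also have "\<dots> = of_bool (e \<inter> C \<noteq> {})"
  proof (cases "e \<inter> C = {}")
    case False
    then have "C \<inter> e = {u} \<or> C \<inter> e = {v}"
      using uv assms(3,4) by auto
    then show ?thesis using False by auto
  qed (simp add: Int_commute)
  finally have "(\<Sum>w\<in>C. of_bool (w \<in> e) :: nat) = of_bool (e \<inter> C \<noteq> {})" .
  moreover have "M \<in> bipartite_multigraphs L R"
    using add.prems by (auto simp: bipartite_multigraphs_def)
  ultimately show ?case
    using add.IH by (simp add: sum.distrib)
qed simp

lemma sum_vdegree_le_size:
  assumes "finite C" "M \<in> bipartite_multigraphs L R" "L \<inter> R = {}" "C \<subseteq> L \<or> C \<subseteq> R"
  shows "(\<Sum>w\<in>C. vdegree M w) \<le> size M"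
  unfolding sum_vdegree_eq[OF assms] by (simp add: size_mset_mono)

lemma sum_vdegree_left:
  assumes "finite L" "M \<in> bipartite_multigraphs L R" "L \<inter> R = {}"
  shows "(\<Sum>w\<in>L. vdegree M w) = size M"
proof -
  have "{#e \<in># M. e \<inter> L \<noteq> {}#} = filter_mset (\<lambda>_. True) M"
    using assms(2) by (intro filter_mset_cong) (auto simp: bipartite_multigraphs_def)
  then show ?thesis
    using sum_vdegree_eq[OF assms] by simp
qed

lemma bipartite_multigraphs_commute: "bipartite_multigraphs L R = bipartite_multigraphs R L"
proof -
  have "(\<exists>u\<in>L. \<exists>v\<in>R. e = {u, v}) \<longleftrightarrow> (\<exists>u\<in>R. \<exists>v\<in>L. e = {u, v})" for e
    using insert_commute by blast
  then show ?thesis by (simp add: bipartite_multigraphs_def)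
qed

lemma sum_vdegree_right:
  assumes "finite R" "M \<in> bipartite_multigraphs L R" "L \<inter> R = {}"
  shows "(\<Sum>w\<in>R. vdegree M w) = size M"
  using assms by (intro sum_vdegree_left[of R M L])
    (simp_all add: bipartite_multigraphs_commute[of R L] Int_commute)

text \<open>Under confinement every edge that meets \<open>A\<close> also meets \<open>B\<close>, so
  counting edges at \<open>A\<close> and at \<open>B\<close> gives the inequality.\<close>

lemma sum_vdegree_confined_le:
  assumes "finite A" "finite B" "A \<subseteq> L" "B \<subseteq> R" "L \<inter> R = {}"
    and M: "M \<in> bipartite_multigraphs L R" and conf: "\<forall>u\<in>A. neighbours M u \<subseteq> B"
  shows "(\<Sum>w\<in>A. vdegree M w) \<le> (\<Sum>w\<in>B. vdegree M w)"
proof -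
  have "e \<inter> B \<noteq> {}" if "e \<in># M" "e \<inter> A \<noteq> {}" for e
  proof -
    from that(1) M obtain u v where uv: "e = {u, v}" "u \<in> L" "v \<in> R"
      by (auto simp: bipartite_multigraphs_def)
    with that assms(3,5) have "u \<in> A" by auto
    moreover have "v \<in> neighbours M u"
      using that(1) uv by (simp add: neighbours_def)
    ultimately show ?thesis using conf uv by blast
  qed
  then have "{#e \<in># M. e \<inter> A \<noteq> {}#} \<subseteq># {#e \<in># M. e \<inter> B \<noteq> {}#}"
    by (intro filter_mset_mono_strong) auto
  then show ?thesis
    using assms by (simp add: sum_vdegree_eq[of _ M L R] size_mset_mono)
qed

section \<open>Urn states and the weights of their transitions\<close>

definition urn_state ::
  "'v set \<Rightarrow> 'v set \<Rightarrow> 'v set \<Rightarrow> 'v set \<Rightarrow> nat \<Rightarrow> nat \<Rightarrow> nat \<Rightarrow> 'v multigraph set" where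
  "urn_state L R A B i j k = confined_multigraphs L R (i + j + k) A B i j"

text \<open>The ends of the new edge give four types; the type from \<open>A\<close> to
  \<open>R - B\<close> breaks confinement and has no disjunct. The positivity guards are there
  because truncated subtraction would make 0 its own predecessor.\<close>

lemma add_mset_urn_state_iff:
  assumes fin: "finite A" "finite B" and AB: "A \<subseteq> L" "B \<subseteq> R" and disj: "L \<inter> R = {}"
    and uv: "u \<in> L" "v \<in> R"
  shows "add_mset {u, v} M \<in> urn_state L R A B i j k \<longleftrightarrow>
     u \<in> A \<and> v \<in> B \<and> i > 0 \<and> M \<in> urn_state L R A B (i - 1) j k
   \<or> u \<notin> A \<and> v \<in> B \<and> j > 0 \<and> M \<in> urn_state L R A B i (j - 1) k
   \<or> u \<notin> A \<and> v \<notin> B \<and> k > 0 \<and> M \<in> urn_state L R A B i j (k - 1)"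
proof (cases "M \<in> bipartite_multigraphs L R \<and> (\<forall>w\<in>A. neighbours M w \<subseteq> B)")
  case True
  have "(\<Sum>w\<in>A. of_bool (w = u \<or> w = v) :: nat) = (\<Sum>w\<in>A. if w = u then 1 else 0)"
    using uv AB disj by (intro sum.cong) auto
  then have dA: "(\<Sum>w\<in>A. vdegree (add_mset {u, v} M) w) = (\<Sum>w\<in>A. vdegree M w) + of_bool (u \<in> A)"
    using fin by (simp add: sum.distrib)
  have "(\<Sum>w\<in>B. of_bool (w = u \<or> w = v) :: nat) = (\<Sum>w\<in>B. if w = v then 1 else 0)"
    using uv AB disj by (intro sum.cong) auto
  then have dB: "(\<Sum>w\<in>B. vdegree (add_mset {u, v} M) w) = (\<Sum>w\<in>B. vdegree M w) + of_bool (v \<in> B)"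
    using fin by (simp add: sum.distrib)
  have nb: "(\<forall>w\<in>A. neighbours (add_mset {u, v} M) w \<subseteq> B) \<longleftrightarrow> (u \<in> A \<longrightarrow> v \<in> B)"
    using True AB uv disj by (auto simp: neighbours_add_mset[of u L v R] subset_iff split: if_splits)
  \<comment> \<open>The two inequalities supply the guards. If \<open>u \<notin> A\<close> and
    \<open>v \<in> B\<close>, the first forces \<open>j > 0\<close>; if \<open>u \<notin> A\<close>
    and \<open>v \<notin> B\<close>, the second forces \<open>k > 0\<close>.\<close>
  have "(\<Sum>w\<in>A. vdegree M w) \<le> (\<Sum>w\<in>B. vdegree M w)"
    using sum_vdegree_confined_le[OF fin AB disj] True by blast
  moreover have "(\<Sum>w\<in>B. vdegree M w) \<le> size M"
    using sum_vdegree_le_size[OF fin(2) _ disj] True AB by blast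
  ultimately show ?thesis
    unfolding urn_state_def confined_multigraphs_def mem_Collect_eq dA dB nb
      bipartite_multigraphs_add_mset[OF uv]
    using True by (cases "u \<in> A"; cases "v \<in> B") auto
next
  case False
  \<comment> \<open>Neighbourhoods only grow and bipartiteness is unaffected by the new edge, so the
    failure for \<open>M\<close> persists and both sides are false.\<close>
  have mono: "neighbours M w \<subseteq> neighbours (add_mset {u, v} M) w" for w
    by (auto simp: neighbours_def)
  have notin: "N \<notin> urn_state L R A B i' j' k'"
    if "\<not> (N \<in> bipartite_multigraphs L R \<and> (\<forall>w\<in>A. neighbours N w \<subseteq> B))" for N i' j' k'
    using that unfolding urn_state_def confined_multigraphs_def by blast
  have "\<not> (add_mset {u, v} M \<in> bipartite_multigraphs L R
      \<and> (\<forall>w\<in>A. neighbours (add_mset {u, v} M) w \<subseteq> B))"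
    using False mono unfolding bipartite_multigraphs_add_mset[OF uv] by (meson subset_trans)
  then show ?thesis
    by (simp only: notin notin[OF False] simp_thms)
qed

text \<open>The weight of a pair is a product of a factor in \<open>u\<close> and a factor in
  \<open>v\<close>, so its sum over a rectangle factorises. On \<open>L\<close> and \<open>R\<close>
  themselves both degree sums equal the number of edges, which gives the denominator.\<close>

lemma sum_edge_prob:
  assumes fin: "finite L" "finite R" and disj: "L \<inter> R = {}"
    and M: "M \<in> bipartite_multigraphs L R"
  shows "(\<Sum>u\<in>C. \<Sum>v\<in>D. edge_prob L R \<alpha> \<beta> M u v) =
     (real (\<Sum>u\<in>C. vdegree M u) + real (card C) * \<alpha>) * (real (\<Sum>v\<in>D. vdegree M v) + real (card D) * \<beta>)
     / ((real (size M) + \<alpha> * real (card L)) * (real (size M) + \<beta> * real (card R)))"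
proof -
  have prod: "(\<Sum>u\<in>C. \<Sum>v\<in>D. (real (vdegree M u) + \<alpha>) * (real (vdegree M v) + \<beta>)) =
      (real (\<Sum>u\<in>C. vdegree M u) + real (card C) * \<alpha>)
      * (real (\<Sum>v\<in>D. vdegree M v) + real (card D) * \<beta>)" for C D
    by (simp add: sum_product[symmetric] sum.distrib)
  show ?thesis
    unfolding edge_prob_def sum_divide_distrib[symmetric] prod
      sum_vdegree_left[OF fin(1) M disj] sum_vdegree_right[OF fin(2) M disj]
    by (simp add: mult.commute)
qed

text \<open>All edges of one type require the same predecessor state, so the sum splits over three
  rectangles. On each of them the predecessor state fixes the degree sums, hence the weight.\<close>

lemma sum_edge_prob_urn_step:
  fixes \<alpha> \<beta> :: real
  assumes fin: "finite L" "finite R" and AB: "A \<subseteq> L" "B \<subseteq> R" and disj: "L \<inter> R = {}"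
    and M: "M \<in> bipartite_multigraphs L R" "size M = t"
  shows "(\<Sum>u\<in>L. \<Sum>v\<in>R. of_bool (add_mset {u, v} M \<in> urn_state L R A B i j k) * edge_prob L R \<alpha> \<beta> M u v)
    = (of_bool (i > 0) * of_bool (M \<in> urn_state L R A B (i - 1) j k)
        * ((real (i - 1) + real (card A) * \<alpha>) * (real (i - 1 + j) + real (card B) * \<beta>))
      + of_bool (j > 0) * of_bool (M \<in> urn_state L R A B i (j - 1) k)
        * ((real (j - 1 + k) + (real (card L) - real (card A)) * \<alpha>) * (real (i + (j - 1)) + real (card B) * \<beta>))
      + of_bool (k > 0) * of_bool (M \<in> urn_state L R A B i j (k - 1))
        * ((real (j + (k - 1)) + (real (card L) - real (card A)) * \<alpha>) * (real (k - 1) + (real (card R) - real (card B)) * \<beta>)))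
      / ((real t + \<alpha> * real (card L)) * (real t + \<beta> * real (card R)))"
    (is "?lhs = (?w1 + ?w2 + ?w3) / ?Z")
proof -
  let ?e = "edge_prob L R \<alpha> \<beta> M"
  let ?p = "\<lambda>C D. \<Sum>u\<in>C. \<Sum>v\<in>D. ?e u v"
  have finAB: "finite A" "finite B"
    using fin AB finite_subset by blast+
  \<comment> \<open>Whether \<open>M\<close> is the predecessor required by each type; these factors
    do not depend on \<open>u\<close> and \<open>v\<close> and leave the double sum.\<close>
  define c1 c2 c3 :: real where
    c: "c1 = of_bool (i > 0 \<and> M \<in> urn_state L R A B (i - 1) j k)"
       "c2 = of_bool (j > 0 \<and> M \<in> urn_state L R A B i (j - 1) k)"
       "c3 = of_bool (k > 0 \<and> M \<in> urn_state L R A B i j (k - 1))"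
  \<comment> \<open>Writing rectangles by indicators puts all three contributions under one sum over
    \<open>L\<close> and \<open>R\<close>.\<close>
  have restr: "?p C D = (\<Sum>u\<in>L. \<Sum>v\<in>R. of_bool (u \<in> C) * of_bool (v \<in> D) * ?e u v)"
    if "C \<subseteq> L" "D \<subseteq> R" for C D
  proof -
    have "(\<Sum>u\<in>L. \<Sum>v\<in>R. of_bool (u \<in> C) * of_bool (v \<in> D) * ?e u v)
        = (\<Sum>u\<in>L. of_bool (u \<in> C) * (\<Sum>v\<in>R. of_bool (v \<in> D) * ?e u v))"
      by (simp add: sum_distrib_left mult.assoc)
    also have "\<dots> = (\<Sum>u\<in>L. if u \<in> C then \<Sum>v\<in>R. if v \<in> D then ?e u v else 0 else 0)"
      by (intro sum.cong refl) (auto intro!: sum.cong)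
    also have "\<dots> = ?p C D"
      using that fin by (simp add: sum.inter_restrict[symmetric] Int_absorb1)
    finally show ?thesis by simp
  qed
  have "?lhs = (\<Sum>u\<in>L. \<Sum>v\<in>R. c1 * (of_bool (u \<in> A) * of_bool (v \<in> B) * ?e u v)
      + c2 * (of_bool (u \<in> L - A) * of_bool (v \<in> B) * ?e u v)
      + c3 * (of_bool (u \<in> L - A) * of_bool (v \<in> R - B) * ?e u v))"
    by (intro sum.cong refl)
       (auto simp: c add_mset_urn_state_iff[OF finAB AB disj])
  also have "\<dots> = c1 * ?p A B + c2 * ?p (L - A) B + c3 * ?p (L - A) (R - B)"
    using AB by (simp add: restr sum.distrib sum_distrib_left)
  finally have split: "?lhs = c1 * ?p A B + c2 * ?p (L - A) B + c3 * ?p (L - A) (R - B)" .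
  note p = sum_edge_prob[OF fin disj M(1)]
  have dL: "real (\<Sum>u\<in>L - A. vdegree M u) = real t - real (\<Sum>u\<in>A. vdegree M u)"
    using sum.subset_diff[OF AB(1) fin(1), of "vdegree M"] sum_vdegree_left[OF fin(1) M(1) disj] M(2)
    by simp
  have dR: "real (\<Sum>u\<in>R - B. vdegree M u) = real t - real (\<Sum>u\<in>B. vdegree M u)"
    using sum.subset_diff[OF AB(2) fin(2), of "vdegree M"] sum_vdegree_right[OF fin(2) M(1) disj] M(2)
    by simp
  have cards: "real (card (L - A)) = real (card L) - real (card A)"
      "real (card (R - B)) = real (card R) - real (card B)"
    using AB fin finAB by (simp_all add: card_Diff_subset card_mono of_nat_diff)
  \<comment> \<open>Either \<open>M\<close> is the predecessor and its degree sums are known, or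
    both sides vanish; likewise for the other two types, with complements obtained from
    \<open>dL\<close> and \<open>dR\<close>.\<close>
  have "c1 * ?p A B = ?w1 / ?Z"
  proof (cases "i > 0 \<and> M \<in> urn_state L R A B (i - 1) j k")
    case True
    then have "(\<Sum>u\<in>A. vdegree M u) = i - 1" "(\<Sum>v\<in>B. vdegree M v) = i - 1 + j"
      by (auto simp: urn_state_def confined_multigraphs_def)
    then show ?thesis using True unfolding p M(2) c by simp
  qed (auto simp: c)
  moreover have "c2 * ?p (L - A) B = ?w2 / ?Z"
  proof (cases "j > 0 \<and> M \<in> urn_state L R A B i (j - 1) k")
    case True
    then have "(\<Sum>u\<in>A. vdegree M u) = i" "(\<Sum>v\<in>B. vdegree M v) = i + (j - 1)"
      and "t = i + (j - 1) + k"
      using M(2) by (auto simp: urn_state_def confined_multigraphs_def)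
    then show ?thesis using True unfolding p M(2) c dL cards by simp
  qed (auto simp: c)
  moreover have "c3 * ?p (L - A) (R - B) = ?w3 / ?Z"
  proof (cases "k > 0 \<and> M \<in> urn_state L R A B i j (k - 1)")
    case True
    then have "(\<Sum>u\<in>A. vdegree M u) = i" "(\<Sum>v\<in>B. vdegree M v) = i + j"
      and "t = i + j + (k - 1)"
      using M(2) by (auto simp: urn_state_def confined_multigraphs_def)
    then show ?thesis using True unfolding p M(2) c dL dR cards by simp
  qed (auto simp: c)
  ultimately show ?thesis
    unfolding split by (simp add: add_divide_distrib)
qed

section \<open>From the conditional law of the process to one-step probabilities\<close>

context bipartite_multigraph_process
begin

text \<open>A carrier of \<open>X t\<close> up to a null set; it is finite for finite parts, so
  events about \<open>X t\<close> become finite sums over atoms.\<close>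

definition reachable :: "nat \<Rightarrow> 'v multigraph set" where
  "reachable t = {M \<in> bipartite_multigraphs L R. size M = t}"

lemma finite_reachable:
  assumes "finite L" "finite R"
  shows "finite (reachable t)"
proof (rule finite_subset)
  show "reachable t \<subseteq> multisets_of_size ((\<lambda>(u, v). {u, v}) ` (L \<times> R)) t"
    by (force simp: reachable_def multisets_of_size_def bipartite_multigraphs_def)
  show "finite (multisets_of_size ((\<lambda>(u, v). {u, v}) ` (L \<times> R)) t)"
    using assms by (intro finite_multisets_of_size) auto
qed

text \<open>Only countably many steps have exceptional null sets, so one null set serves all times
  and the induction runs along each remaining path.\<close>

lemma AE_reachable: "AE \<omega> in \<Omega>. \<forall>t. X t \<omega> \<in> reachable t"
proof -
  have "AE \<omega> in \<Omega>. \<forall>t. \<exists>u\<in>L. \<exists>v\<in>R. X (Suc t) \<omega> = add_mset {u, v} (X t \<omega>)"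
    using step by (simp add: AE_all_countable)
  with init show ?thesis
  proof eventually_elim
    case (elim \<omega>)
    show ?case
    proof
      fix t show "X t \<omega> \<in> reachable t"
      proof (induction t)
        case 0
        then show ?case using elim(1) by (simp add: reachable_def bipartite_multigraphs_def)
      next
        case (Suc t)
        from elim(2) obtain u v where "u \<in> L" "v \<in> R" "X (Suc t) \<omega> = add_mset {u, v} (X t \<omega>)"
          by blast
        then show ?case
          using Suc by (simp add: reachable_def bipartite_multigraphs_add_mset)
      qed
    qed
  qed
qed

lemma measurable_state_mem: "{\<omega> \<in> space \<Omega>. X t \<omega> \<in> S} \<in> events"
proof -
  \<comment> \<open>\<open>S\<close> is arbitrary, so it is first cut down to the target space of
    \<open>X t\<close>.\<close>
  have "{\<omega> \<in> space \<Omega>. X t \<omega> \<in> S} = X t -` (S \<inter> bipartite_multigraphs L R) \<inter> space \<Omega>"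
    using measurable_space[OF measurable_state[of t]] by auto
  also have "\<dots> \<in> events"
    by (rule measurable_sets[OF measurable_state]) auto
  finally show ?thesis .
qed

lemma measurable_state_eq [measurable]: "{\<omega> \<in> space \<Omega>. X t \<omega> = M} \<in> events"
  using measurable_state_mem[of t "{M}"] by simp

text \<open>The axiom \<open>transition\<close> conditions on the whole past. Summing over all pasts
  that end in \<open>M\<close> removes the history, because the edge law depends on the last state
  alone and is a common factor.\<close>

lemma prob_step:
  assumes "finite L" "finite R" and uv: "u \<in> L" "v \<in> R" and M: "M \<in> reachable t"
  shows "\<P>(\<omega> in \<Omega>. X (Suc t) \<omega> = add_mset {u, v} M \<and> X t \<omega> = M)
    = \<P>(\<omega> in \<Omega>. X t \<omega> = M) * edge_prob L R \<alpha> \<beta> M u v"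
proof -
  \<comment> \<open>Extensional functions make this set of pasts finite and give each trajectory
    exactly one representative.\<close>
  define I where "I = {H \<in> PiE {..t} reachable. H t = M}"
  have "finite I"
    unfolding I_def using assms by (simp add: finite_PiE finite_reachable)
  have past: "{\<omega> \<in> space \<Omega>. \<forall>s\<le>t. X s \<omega> = H s} \<in> events" for H
    by measurable
  have unique: "\<exists>!H\<in>I. \<forall>s\<le>t. X s \<omega> = H s"
    if "\<forall>s. X s \<omega> \<in> reachable s" "X t \<omega> = M" for \<omega>
  proof (rule ex1I[of _ "restrict (\<lambda>s. X s \<omega>) {..t}"])
    fix H assume "H \<in> I \<and> (\<forall>s\<le>t. X s \<omega> = H s)"
    then show "H = restrict (\<lambda>s. X s \<omega>) {..t}"
      by (intro ext) (auto simp: I_def PiE_iff extensional_def)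
  qed (use that in \<open>auto simp: I_def\<close>)
  have one: "\<P>(\<omega> in \<Omega>. X (Suc t) \<omega> = add_mset {u, v} M \<and> (\<forall>s\<le>t. X s \<omega> = H s))
      = \<P>(\<omega> in \<Omega>. \<forall>s\<le>t. X s \<omega> = H s) * edge_prob L R \<alpha> \<beta> M u v" if "H \<in> I" for H
  proof (cases "\<P>(\<omega> in \<Omega>. \<forall>s\<le>t. X s \<omega> = H s) > 0")
    case True
    with transition[OF True uv] that show ?thesis
      by (simp add: cond_prob_def I_def field_simps)
  next
    case False
    \<comment> \<open>Nothing is prescribed after a null past, but then the joint event is null as
      well and both sides are 0.\<close>
    then have "\<P>(\<omega> in \<Omega>. \<forall>s\<le>t. X s \<omega> = H s) = 0"
      using measure_nonneg by (simp add: not_less order_antisym)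
    moreover have "\<P>(\<omega> in \<Omega>. X (Suc t) \<omega> = add_mset {u, v} M \<and> (\<forall>s\<le>t. X s \<omega> = H s))
        \<le> \<P>(\<omega> in \<Omega>. \<forall>s\<le>t. X s \<omega> = H s)"
      using past by (intro finite_measure_mono) auto
    ultimately show ?thesis
      by (simp add: order_antisym)
  qed
  have "\<P>(\<omega> in \<Omega>. X (Suc t) \<omega> = add_mset {u, v} M \<and> X t \<omega> = M)
      = (\<Sum>H\<in>I. \<P>(\<omega> in \<Omega>. X (Suc t) \<omega> = add_mset {u, v} M \<and> (\<forall>s\<le>t. X s \<omega> = H s)))"
  proof (rule prob_sum[OF \<open>finite I\<close>])
    show "AE \<omega> in \<Omega>. (\<forall>H\<in>I. X (Suc t) \<omega> = add_mset {u, v} M \<and> (\<forall>s\<le>t. X s \<omega> = H s)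
        \<longrightarrow> X (Suc t) \<omega> = add_mset {u, v} M \<and> X t \<omega> = M)
      \<and> (X (Suc t) \<omega> = add_mset {u, v} M \<and> X t \<omega> = M
        \<longrightarrow> (\<exists>!H\<in>I. X (Suc t) \<omega> = add_mset {u, v} M \<and> (\<forall>s\<le>t. X s \<omega> = H s)))"
      using AE_reachable
    proof eventually_elim
      case (elim \<omega>)
      then show ?case using unique[of \<omega>] by (auto simp: I_def)
    qed
  qed measurable
  also have "\<dots> = (\<Sum>H\<in>I. \<P>(\<omega> in \<Omega>. \<forall>s\<le>t. X s \<omega> = H s)) * edge_prob L R \<alpha> \<beta> M u v"
    by (simp add: one sum_distrib_right)
  also have "(\<Sum>H\<in>I. \<P>(\<omega> in \<Omega>. \<forall>s\<le>t. X s \<omega> = H s)) = \<P>(\<omega> in \<Omega>. X t \<omega> = M)"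
  proof (rule prob_sum[OF \<open>finite I\<close>, symmetric])
    show "AE \<omega> in \<Omega>. (\<forall>H\<in>I. (\<forall>s\<le>t. X s \<omega> = H s) \<longrightarrow> X t \<omega> = M)
      \<and> (X t \<omega> = M \<longrightarrow> (\<exists>!H\<in>I. \<forall>s\<le>t. X s \<omega> = H s))"
      using AE_reachable
    proof eventually_elim
      case (elim \<omega>)
      then show ?case using unique[of \<omega>] by (auto simp: I_def)
    qed
  qed measurable
  finally show ?thesis .
qed

text \<open>Law of total probability over the present state and the two ends of the next
  edge.\<close>

lemma prob_Suc_mem:
  assumes fin: "finite L" "finite R" and disj: "L \<inter> R = {}"
  shows "\<P>(\<omega> in \<Omega>. X (Suc t) \<omega> \<in> S) = (\<Sum>M\<in>reachable t. \<P>(\<omega> in \<Omega>. X t \<omega> = M)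
      * (\<Sum>u\<in>L. \<Sum>v\<in>R. of_bool (add_mset {u, v} M \<in> S) * edge_prob L R \<alpha> \<beta> M u v))"
proof -
  define I where "I = reachable t \<times> (L \<times> R)"
  \<comment> \<open>Membership in \<open>S\<close> is part of the event, so triples leading outside
    \<open>S\<close> give the empty event and later the factor 0.\<close>
  define P where "P = (\<lambda>(M, u, v) \<omega>. (X (Suc t) \<omega> = add_mset {u, v} M \<and> X t \<omega> = M)
      \<and> add_mset {u, v} M \<in> S)"
  have "\<P>(\<omega> in \<Omega>. X (Suc t) \<omega> \<in> S) = (\<Sum>x\<in>I. \<P>(\<omega> in \<Omega>. P x \<omega>))"
  proof (rule prob_sum)
    show "finite I"
      using fin by (simp add: I_def finite_reachable)
    show "{\<omega> \<in> space \<Omega>. P x \<omega>} \<in> events" for x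
      unfolding P_def by (cases x) simp
    show "{\<omega> \<in> space \<Omega>. X (Suc t) \<omega> \<in> S} \<in> events"
      by (rule measurable_state_mem)
    show "AE \<omega> in \<Omega>. (\<forall>x\<in>I. P x \<omega> \<longrightarrow> X (Suc t) \<omega> \<in> S)
        \<and> (X (Suc t) \<omega> \<in> S \<longrightarrow> (\<exists>!x\<in>I. P x \<omega>))"
      using AE_reachable step[of t]
    proof eventually_elim
      case (elim \<omega>)
      then obtain u v where uv: "u \<in> L" "v \<in> R" "X (Suc t) \<omega> = add_mset {u, v} (X t \<omega>)"
        by blast
      \<comment> \<open>Disjointness of the parts lets the unordered edge determine its left and
        right ends, so distinct triples give disjoint events.\<close>
      have "x = (X t \<omega>, u, v)" if "x \<in> I" "P x \<omega>" for x
        using that uv disj by (cases x) (auto simp: I_def P_def doubleton_eq_iff)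
      moreover have "X (Suc t) \<omega> \<in> S \<longrightarrow> (X t \<omega>, u, v) \<in> I \<and> P (X t \<omega>, u, v) \<omega>"
        using elim uv by (auto simp: I_def P_def)
      moreover have "\<forall>x\<in>I. P x \<omega> \<longrightarrow> X (Suc t) \<omega> \<in> S"
        by (auto simp: P_def)
      ultimately show ?case
        by blast
    qed
  qed
  also have "\<dots> = (\<Sum>(M, u, v)\<in>I. \<P>(\<omega> in \<Omega>. X t \<omega> = M)
      * (of_bool (add_mset {u, v} M \<in> S) * edge_prob L R \<alpha> \<beta> M u v))"
    using prob_step[OF fin] by (intro sum.cong) (auto simp: I_def P_def)
  finally show ?thesis
    by (simp add: I_def sum.cartesian_product[symmetric] sum_distrib_left)
qed

lemma prob_mem_eq_sum:
  assumes "finite L" "finite R"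
  shows "\<P>(\<omega> in \<Omega>. X t \<omega> \<in> S) = (\<Sum>M\<in>reachable t. \<P>(\<omega> in \<Omega>. X t \<omega> = M) * of_bool (M \<in> S))"
proof -
  have "\<P>(\<omega> in \<Omega>. X t \<omega> \<in> S) = (\<Sum>M\<in>reachable t. \<P>(\<omega> in \<Omega>. X t \<omega> = M \<and> M \<in> S))"
  proof (rule prob_sum)
    show "AE \<omega> in \<Omega>. (\<forall>M\<in>reachable t. X t \<omega> = M \<and> M \<in> S \<longrightarrow> X t \<omega> \<in> S)
        \<and> (X t \<omega> \<in> S \<longrightarrow> (\<exists>!M\<in>reachable t. X t \<omega> = M \<and> M \<in> S))"
      using AE_reachable by eventually_elim auto
  qed (use assms in \<open>simp_all add: finite_reachable measurable_state_mem\<close>)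
  also have "\<dots> = (\<Sum>M\<in>reachable t. \<P>(\<omega> in \<Omega>. X t \<omega> = M) * of_bool (M \<in> S))"
    by (intro sum.cong) auto
  finally show ?thesis .
qed

text \<open>Averaging \<open>sum_edge_prob_urn_step\<close> over the state at time \<open>t\<close>
  turns the membership indicators into probabilities.\<close>

lemma prob_urn_Suc:
  assumes fin: "finite L" "finite R" and AB: "A \<subseteq> L" "B \<subseteq> R" and disj: "L \<inter> R = {}"
  shows "\<P>(\<omega> in \<Omega>. X (Suc t) \<omega> \<in> urn_state L R A B i j k)
    = (of_bool (i > 0) * \<P>(\<omega> in \<Omega>. X t \<omega> \<in> urn_state L R A B (i - 1) j k)
        * ((real (i - 1) + real (card A) * \<alpha>) * (real (i - 1 + j) + real (card B) * \<beta>))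
      + of_bool (j > 0) * \<P>(\<omega> in \<Omega>. X t \<omega> \<in> urn_state L R A B i (j - 1) k)
        * ((real (j - 1 + k) + (real (card L) - real (card A)) * \<alpha>) * (real (i + (j - 1)) + real (card B) * \<beta>))
      + of_bool (k > 0) * \<P>(\<omega> in \<Omega>. X t \<omega> \<in> urn_state L R A B i j (k - 1))
        * ((real (j + (k - 1)) + (real (card L) - real (card A)) * \<alpha>) * (real (k - 1) + (real (card R) - real (card B)) * \<beta>)))
      / ((real t + \<alpha> * real (card L)) * (real t + \<beta> * real (card R)))"
proof -
  \<comment> \<open>Linearity, stated with abstract coefficients: the weights do not depend on
    \<open>M\<close> and move out of the sum.\<close>
  have lin: "(\<Sum>M\<in>S. p M * ((e1 * o1 M * w1 + e2 * o2 M * w2 + e3 * o3 M * w3) / Z))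
      = (e1 * (\<Sum>M\<in>S. p M * o1 M) * w1 + e2 * (\<Sum>M\<in>S. p M * o2 M) * w2
        + e3 * (\<Sum>M\<in>S. p M * o3 M) * w3) / Z"
    for S :: "'v multigraph set" and p o1 o2 o3 :: "'v multigraph \<Rightarrow> real" and e1 e2 e3 w1 w2 w3 Z :: real
  proof -
    have "(\<Sum>M\<in>S. p M * ((e1 * o1 M * w1 + e2 * o2 M * w2 + e3 * o3 M * w3) / Z))
        = (\<Sum>M\<in>S. (e1 * (p M * o1 M) * w1 + e2 * (p M * o2 M) * w2 + e3 * (p M * o3 M) * w3) / Z)"
      by (intro sum.cong refl) (simp add: distrib_left mult_ac)
    then show ?thesis
      by (simp only: sum_divide_distrib[symmetric] sum.distrib sum_distrib_left[symmetric]
            sum_distrib_right[symmetric])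
  qed
  note step' = sum_edge_prob_urn_step[OF fin AB disj, where t = t]
  have "\<P>(\<omega> in \<Omega>. X (Suc t) \<omega> \<in> urn_state L R A B i j k) =
     (\<Sum>M\<in>reachable t. \<P>(\<omega> in \<Omega>. X t \<omega> = M)
      * (\<Sum>u\<in>L. \<Sum>v\<in>R. of_bool (add_mset {u, v} M \<in> urn_state L R A B i j k)
          * edge_prob L R \<alpha> \<beta> M u v))"
    by (rule prob_Suc_mem[OF fin disj])
  also have "\<dots> = (\<Sum>M\<in>reachable t. \<P>(\<omega> in \<Omega>. X t \<omega> = M) *
   ((of_bool (i > 0) * of_bool (M \<in> urn_state L R A B (i - 1) j k)
        * ((real (i - 1) + real (card A) * \<alpha>) * (real (i - 1 + j) + real (card B) * \<beta>))
      + of_bool (j > 0) * of_bool (M \<in> urn_state L R A B i (j - 1) k)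
        * ((real (j - 1 + k) + (real (card L) - real (card A)) * \<alpha>) * (real (i + (j - 1)) + real (card B) * \<beta>))
      + of_bool (k > 0) * of_bool (M \<in> urn_state L R A B i j (k - 1))
        * ((real (j + (k - 1)) + (real (card L) - real (card A)) * \<alpha>) * (real (k - 1) + (real (card R) - real (card B)) * \<beta>)))
      / ((real t + \<alpha> * real (card L)) * (real t + \<beta> * real (card R)))))"
    by (intro sum.cong refl arg_cong2[where f = "(*)"] step') (auto simp: reachable_def)
  finally show ?thesis
    unfolding prob_mem_eq_sum[OF fin, of t] lin .
qed

end

section \<open>The closed form and its recurrence\<close>

text \<open>The trinomial coefficient counts the orders of the edge types. The two quotients are
  Polya urn probabilities of one fixed order, for the left ends and for the right ends.\<close>

definition urn_law ::
  "real \<Rightarrow> real \<Rightarrow> real \<Rightarrow> real \<Rightarrow> nat \<Rightarrow> nat \<Rightarrow> nat \<Rightarrow> real" where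
  "urn_law a a' b b' i j k = fact (i + j + k) / (fact i * fact j * fact k)
     * (pochhammer a i * pochhammer a' (j + k) / pochhammer (a + a') (i + j + k))
     * (pochhammer b (i + j) * pochhammer b' k / pochhammer (b + b') (i + j + k))"

text \<open>Each weight is the last factor of the rising factorials that the edge type extends. The
  three terms thus become \<open>i\<close>, \<open>j\<close> and \<open>k\<close> times one quantity
  \<open>h\<close>, and \<open>i + j + k = Suc t\<close> is the trinomial recurrence.\<close>

lemma urn_law_recurrence:
  assumes "i + j + k = Suc t"
  shows "urn_law a a' b b' i j k =
    (of_bool (i > 0) * urn_law a a' b b' (i - 1) j k * ((real (i - 1) + a) * (real (i - 1 + j) + b))
     + of_bool (j > 0) * urn_law a a' b b' i (j - 1) k * ((real (j - 1 + k) + a') * (real (i + (j - 1)) + b))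
     + of_bool (k > 0) * urn_law a a' b b' i j (k - 1) * ((real (j + (k - 1)) + a') * (real (k - 1) + b')))
    / ((real t + (a + a')) * (real t + (b + b')))"
proof -
  define p where "p = pochhammer a i * pochhammer a' (j + k) * pochhammer b (i + j) * pochhammer b' k"
  define q where "q = pochhammer (a + a') t * pochhammer (b + b') t"
  \<comment> \<open>Numerators of the new triple over denominators of total \<open>t\<close>;
    lowering \<open>i\<close> in a factorial accounts for the factor \<open>real i\<close>
    below.\<close>
  define h where "h = fact t / (fact i * fact j * fact k) * p / q"
  define Z where "Z = (real t + (a + a')) * (real t + (b + b'))"
  have law: "urn_law a a' b b' i' j' k' = fact t / (fact i' * fact j' * fact k')
      * (pochhammer a i' * pochhammer a' (j' + k') * pochhammer b (i' + j') * pochhammer b' k') / q"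
    if "i' + j' + k' = t" for i' j' k'
    unfolding urn_law_def that q_def by simp
  have i: "of_bool (i > 0) * urn_law a a' b b' (i - 1) j k
      * ((real (i - 1) + a) * (real (i - 1 + j) + b)) = real i * h"
  proof (cases i)
    case (Suc i')
    with assms have "i' + j + k = t" by simp
    from law[OF this] show ?thesis
      by (simp add: h_def p_def Suc pochhammer_Suc add.commute mult_ac del: of_nat_Suc)
  qed simp
  have j: "of_bool (j > 0) * urn_law a a' b b' i (j - 1) k
      * ((real (j - 1 + k) + a') * (real (i + (j - 1)) + b)) = real j * h"
  proof (cases j)
    case (Suc j')
    with assms have "i + j' + k = t" by simp
    from law[OF this] show ?thesis
      by (simp add: h_def p_def Suc pochhammer_Suc add.commute mult_ac del: of_nat_Suc)
  qed simp
  have k: "of_bool (k > 0) * urn_law a a' b b' i j (k - 1)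
      * ((real (j + (k - 1)) + a') * (real (k - 1) + b')) = real k * h"
  proof (cases k)
    case (Suc k')
    with assms have "i + j + k' = t" by simp
    from law[OF this] show ?thesis
      by (simp add: h_def p_def Suc pochhammer_Suc add.commute mult_ac del: of_nat_Suc)
  qed simp
  \<comment> \<open>\<open>fact (Suc t)\<close> gives \<open>real (Suc t)\<close>, and the last
    factors of the two denominators form \<open>Z\<close>.\<close>
  have "urn_law a a' b b' i j k = real (Suc t) * h / Z"
    unfolding urn_law_def h_def p_def q_def Z_def assms pochhammer_Suc fact_Suc
    by (simp add: add.commute mult_ac del: of_nat_Suc)
  also have "real (Suc t) = real i + real j + real k"
    using assms by linarith
  finally show ?thesis
    unfolding i j k Z_def by (simp only: distrib_right)
qed

section \<open>Induction on time and the final formula\<close>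

lemma (in bipartite_multigraph_process) prob_urn_state:
  assumes fin: "finite L" "finite R" and AB: "A \<subseteq> L" "B \<subseteq> R" and disj: "L \<inter> R = {}"
  shows "i + j + k = t \<Longrightarrow> \<P>(\<omega> in \<Omega>. X t \<omega> \<in> urn_state L R A B i j k) =
    urn_law (real (card A) * \<alpha>) ((real (card L) - real (card A)) * \<alpha>)
      (real (card B) * \<beta>) ((real (card R) - real (card B)) * \<beta>) i j k"
proof (induction t arbitrary: i j k)
  case 0
  have "{#} \<in> urn_state L R A B 0 0 0"
    by (simp add: urn_state_def confined_multigraphs_def bipartite_multigraphs_def neighbours_def)
  then have "\<P>(\<omega> in \<Omega>. X 0 \<omega> \<in> urn_state L R A B 0 0 0) = 1"
    using init by (intro prob_Collect_eq_1[THEN iffD2] measurable_state_mem) auto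
  with 0 show ?case
    by (simp add: urn_law_def)
next
  case (Suc t)
  note rec = urn_law_recurrence[OF Suc.prems]
  \<comment> \<open>The guard stays in the equation: at a zero index truncated subtraction leaves
    the total at \<open>Suc t\<close>, where the induction hypothesis is silent and the factor 0
    settles the case.\<close>
  have IH: "of_bool (0 < m) * \<P>(\<omega> in \<Omega>. X t \<omega> \<in> urn_state L R A B i' j' k')
      = of_bool (0 < m) * urn_law (real (card A) * \<alpha>) ((real (card L) - real (card A)) * \<alpha>)
      (real (card B) * \<beta>) ((real (card R) - real (card B)) * \<beta>) i' j' k'"
    if "0 < m \<Longrightarrow> i' + j' + k' = t" for m :: nat and i' j' k'
    using Suc.IH that by (cases "0 < m") auto
  have Z: "real (card A) * \<alpha> + (real (card L) - real (card A)) * \<alpha> = \<alpha> * real (card L)"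
    "real (card B) * \<beta> + (real (card R) - real (card B)) * \<beta> = \<beta> * real (card R)"
    by (simp_all add: algebra_simps)
  show ?case
    unfolding rec prob_urn_Suc[OF fin AB disj] Z
    using Suc.prems by (subst (1 2 3) IH) auto
qed

theorem proposition3p3:
  fixes \<Omega> :: "'o measure" and L R A B :: "'v set" and \<alpha> \<beta> :: real
    and X :: "nat \<Rightarrow> 'o \<Rightarrow> 'v multigraph" and t t1 y :: nat
  assumes "finite L" and "finite R" and "L \<inter> R = {}"
    and "\<alpha> > 0" and "\<beta> > 0"
    and "bipartite_multigraph_process \<Omega> L R \<alpha> \<beta> X"
    and "A \<subseteq> L" and "B \<subseteq> R"
    and "t1 + y \<le> t"
  shows "\<P>(\<omega> in \<Omega>. X t \<omega> \<in> confined_multigraphs L R t A B t1 y) =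
      real (t choose t1) * real ((t - t1) choose y)
      * ((pochhammer (real (card A) * \<alpha>) t1
          * pochhammer ((real (card L) - real (card A)) * \<alpha>) (t - t1))
         / pochhammer (\<alpha> * real (card L)) t)
      * ((pochhammer (real (card B) * \<beta>) (t1 + y)
          * pochhammer ((real (card R) - real (card B)) * \<beta>) (t - t1 - y))
         / pochhammer (\<beta> * real (card R)) t)"
proof -
  interpret bipartite_multigraph_process \<Omega> L R \<alpha> \<beta> X
    by (rule assms(6))
  define k where "k = t - t1 - y"
  have t: "t1 + y + k = t" "t - t1 = y + k"
    using assms(9) by (simp_all add: k_def)
  have Z: "real (card A) * \<alpha> + (real (card L) - real (card A)) * \<alpha> = \<alpha> * real (card L)"
    "real (card B) * \<beta> + (real (card R) - real (card B)) * \<beta> = \<beta> * real (card R)"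
    by (simp_all add: algebra_simps)
  \<comment> \<open>The product of the two binomials is the trinomial coefficient, since
    \<open>fact (y + k)\<close> cancels.\<close>
  have "real (t choose t1) = fact t / (fact t1 * fact (y + k))"
    using binomial_fact[of t1 t, where 'a = real] assms(9) t(2) by simp
  moreover have "real ((t - t1) choose y) = fact (y + k) / (fact y * fact k)"
    using binomial_fact[of y "y + k", where 'a = real] t(2) by simp
  ultimately have trinomial:
    "real (t choose t1) * real ((t - t1) choose y) = fact t / (fact t1 * fact y * fact k)"
    by simp
  show ?thesis
    using prob_urn_state[OF assms(1,2,7,8,3) t(1)]
    unfolding urn_state_def urn_law_def t(1) Z trinomial k_def[symmetric] unfolding t(2) .
qed

end
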